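(* Let $\beta$ be a topological $\mathbb{Z}^d$-action on an infinite compact metric space $X$, let $\mathcal{C}$ be a connected component of $\mathsf{E}_k(\beta)$, and let $y_0\in X$. Then $\Delta_\beta(y_0,V)=\Delta_\beta(y_0,W)$ for all $V,W\in\mathcal{C}$.
   Context: A (topological) $\mathbb{Z}^d$-action $\beta$ on a compact metric space $(X,\rho)$ is a homomorphism $\mathbf{n}\mapsto\beta^{\mathbf{n}}$ from $\mathbb{Z}^d$ to the group of homeomorphisms of $X$. For $F\subset\mathbb{R}^d$ put $\rho_\beta^F(x,y)=\sup\{\rho(\beta^{\mathbf{n}}x,\beta^{\mathbf{n}}y):\mathbf{n}\in F\cap\mathbb{Z}^d\}$ (and $0$ if $F\cap\mathbb{Z}^d=\emptyset$), and for $t>0$ put $F^t=\{\mathbf{x}\in\mathbb{R}^d:\operatorname{dist}(\mathbf{x},F)\le t\}$ (Euclidean distance). $F$ is expansive for $\beta$ if there are $\varepsilon>0$, $t>0$ such that $\rho_\beta^{F^t}(x,y)\le\varepsilon$ implies $x=y$. $\mathsf{G}_k$ is the Grassmann manifold of $k$-dimensional linear subspaces of $\mathbb{R}^d$ with its usual topology, and $\mathsf{E}_k(\beta)=\{V\in\mathsf{G}_k: V\text{ is expansive for }\beta\}$, with the subspace topology. For a linear subspace $V\subset\mathbb{R}^d$ and $y_0\in X$, a point $x\in X$ is homoclinic to $y_0$ along $V$ if there is a $t>0$ such that $\rho(\beta^{\mathbf{n}}(x),\beta^{\mathbf{n}}(y_0))\to0$ as $\|\mathbf{n}\|\to\infty$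 with $\mathbf{n}\in V^t\cap\mathbb{Z}^d$. The set of points homoclinic to $y_0$ along $V$ is denoted $\Delta_\beta(y_0,V)$. *)

theory Defs
  imports "HOL-Analysis.Analysis"
begin

definition Zd_action :: "'a::topological_space set \<Rightarrow> (int ^ 'n \<Rightarrow> 'a \<Rightarrow> 'a) \<Rightarrow> bool" where
  "Zd_action X \<beta> \<longleftrightarrow>
     (\<forall>n. \<exists>g. homeomorphism X X (\<beta> n) g) \<and>
     (\<forall>m n. \<forall>x\<in>X. \<beta> (m + n) x = \<beta> m (\<beta> n x))"

definition lattice_vec :: "int ^ 'n \<Rightarrow> real ^ 'n" where
  "lattice_vec n = (\<chi> i. real_of_int (n $ i))"

definition lattice_points :: "(real ^ 'n) set \<Rightarrow> (int ^ 'n) set" where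
  "lattice_points F = {n. lattice_vec n \<in> F}"

text \<open>For compact \<open>X\<close> and \<open>x, y \<in> X\<close> the set of reals below is bounded, so its supremum is
  the genuine one.\<close>

definition rho :: "(int ^ 'n \<Rightarrow> 'a \<Rightarrow> 'a::metric_space) \<Rightarrow> (real ^ 'n) set \<Rightarrow> 'a \<Rightarrow> 'a \<Rightarrow> real" where
  "rho \<beta> F x y =
     (if lattice_points F = {} then 0
      else (SUP n\<in>lattice_points F. dist (\<beta> n x) (\<beta> n y)))"

text \<open>The condition \<open>F \<noteq> {}\<close> is needed because the library puts \<open>infdist x {} = 0\<close>,
  whereas the distance to the empty set is meant to be infinite.\<close>

definition thicken :: "(real ^ 'n) set \<Rightarrow> real \<Rightarrow> (real ^ 'n) set" where
  "thicken F t = {x. F \<noteq> {} \<and> infdist x F \<le> t}"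

definition expansive ::
  "'a::metric_space set \<Rightarrow> (int ^ 'n \<Rightarrow> 'a \<Rightarrow> 'a) \<Rightarrow> (real ^ 'n) set \<Rightarrow> bool" where
  "expansive X \<beta> F \<longleftrightarrow>
     (\<exists>\<epsilon>>0. \<exists>t>0. \<forall>x\<in>X. \<forall>y\<in>X. rho \<beta> (thicken F t) x y \<le> \<epsilon> \<longrightarrow> x = y)"

text \<open>The Grassmannian carries the topology that makes the map sending a subspace to the matrix
  of its orthogonal projection a topological embedding into the space of \<open>d \<times> d\<close> matrices.
  On a subspace, \<open>closest_point\<close> is the orthogonal projection.\<close>

definition grassmannian :: "nat \<Rightarrow> (real ^ 'n) set topology" where
  "grassmannian k =
     pullback_topology {V. subspace V \<and> dim V = k} (\<lambda>V. matrix (closest_point V)) euclidean"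

definition expansive_subspaces ::
  "'a::metric_space set \<Rightarrow> (int ^ 'n \<Rightarrow> 'a \<Rightarrow> 'a) \<Rightarrow> nat \<Rightarrow> (real ^ 'n) set set" where
  "expansive_subspaces X \<beta> k = {V \<in> topspace (grassmannian k). expansive X \<beta> V}"

definition homoclinic_along ::
  "(int ^ 'n \<Rightarrow> 'a \<Rightarrow> 'a::metric_space) \<Rightarrow> (real ^ 'n) set \<Rightarrow> 'a \<Rightarrow> 'a \<Rightarrow> bool" where
  "homoclinic_along \<beta> V y\<^sub>0 x \<longleftrightarrow>
     (\<exists>t>0. ((\<lambda>n. dist (\<beta> n x) (\<beta> n y\<^sub>0)) \<longlongrightarrow> 0)
              (inf (filtercomap lattice_vec at_infinity)
                   (principal (lattice_points (thicken V t)))))"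

definition homoclinic_set ::
  "'a::metric_space set \<Rightarrow> (int ^ 'n \<Rightarrow> 'a \<Rightarrow> 'a) \<Rightarrow> 'a \<Rightarrow> (real ^ 'n) set \<Rightarrow> 'a set" where
  "homoclinic_set X \<beta> y\<^sub>0 V = {x \<in> X. homoclinic_along \<beta> V y\<^sub>0 x}"

lemma topspace_grassmannian: "topspace (grassmannian k) = {V. subspace V \<and> dim V = k}"
  by (simp add: grassmannian_def topspace_pullback_topology)

end

theory Submission imports Defs begin

text \<open>The set of homoclinic points is locally constant on the expansive subspaces, and hence
  constant on connected components.

  The reason for local constancy is that expansiveness along \<open>V\<close> is a finite coding: by compactness
  there are \<open>\<epsilon>\<close>, \<open>t\<close> such that, for every \<open>s\<close>, two points whose orbits are \<open>\<epsilon>\<close>-close on a sufficiently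
  large piece \<open>V\<^sup>t \<inter> cball 0 R\<close> have orbits that are \<open>\<epsilon>\<close>-close on all of \<open>cball 0 s\<close>
  (\<open>expansive_codes\<close>). With \<open>s\<close> much larger than \<open>t\<close>, closeness on a strip around \<open>V\<close> spreads to a
  wider strip. If \<open>x\<close> is homoclinic to \<open>y\<close> along \<open>V\<close>, their orbits are \<open>\<epsilon>\<close>-close on a strip
  around \<open>V\<close> outside some ball; iterating the spreading step, each step raises the height above \<open>V\<close>
  by \<open>1\<close> and loses a ball radius of \<open>R + s\<close>, so the orbits are \<open>\<epsilon>\<close>-close on a whole cone around \<open>V\<close>
  (\<open>coding_spreads_to_cone\<close>). A subspace \<open>W\<close> at a small enough angle to \<open>V\<close> runs inside this cone, and
  ever larger balls around its far points lie in the cone too. By expansiveness, \<open>\<epsilon>\<close>-closeness on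
  large balls forces closeness at their centres, so \<open>x\<close> is homoclinic to \<open>y\<close> along \<open>W\<close>
  (\<open>homoclinic_along_transfer\<close>). Conversely, a coding depends only on a bounded part of \<open>V\<^sup>t\<close>, so it
  passes to every nearby \<open>W\<close> with the same \<open>R\<close> and \<open>s\<close> (\<open>codes_transfer\<close>); the two subspaces
  therefore play symmetric roles.

  The spreading argument starts from a strip of prescribed width, whereas a homoclinic point comes
  with a width that may be very small. Here \<open>lattice_points_relatively_dense\<close> helps: the lattice points
  in a strip of any positive width are relatively dense along \<open>V\<close>, and equicontinuity of finitely many
  of the maps carries the convergence to every other width
  (\<open>homoclinic_along_any_width\<close>).\<close>

section \<open>Thickened subspaces and lattice points\<close>

lemma mem_thicken_subspace:
  fixes V :: "(real ^ 'n) set"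
  assumes "subspace V"
  shows "x \<in> thicken V t \<longleftrightarrow> (\<exists>v\<in>V. norm (x - v) \<le> t)"
proof -
  have ne: "V \<noteq> {}" using assms subspace_0 by blast
  obtain v where "v \<in> V" "infdist x V = dist x v"
    using infdist_attains_inf[OF closed_subspace[OF assms] ne] by blast
  then show ?thesis
    using ne infdist_le2 by (fastforce simp: thicken_def dist_norm)
qed

lemma thicken_add:
  fixes V :: "(real ^ 'n) set"
  assumes V: "subspace V" and "x \<in> thicken V s" "y \<in> thicken V t"
  shows "x + y \<in> thicken V (s + t)"
proof -
  obtain v w where vw: "v \<in> V" "norm (x - v) \<le> s" "w \<in> V" "norm (y - w) \<le> t"
    using assms by (auto simp: mem_thicken_subspace)
  have "norm ((x + y) - (v + w)) \<le> s + t"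
    using norm_triangle_ineq[of "x - v" "y - w"] vw by (simp add: algebra_simps)
  then show ?thesis
    using vw V by (auto simp: mem_thicken_subspace intro: subspace_add)
qed

lemma thicken_perturb:
  fixes V :: "(real ^ 'n) set"
  assumes V: "subspace V" and "x \<in> thicken V s" "norm (y - x) \<le> r" "s + r \<le> t"
  shows "y \<in> thicken V t"
proof -
  obtain v where v: "v \<in> V" "norm (x - v) \<le> s"
    using assms by (auto simp: mem_thicken_subspace)
  have "norm (y - v) \<le> t"
    using norm_triangle_ineq[of "y - x" "x - v"] v assms by simp
  then show ?thesis using v V by (auto simp: mem_thicken_subspace)
qed

lemma lattice_vec_add: "lattice_vec (m + n) = lattice_vec m + lattice_vec n"
  by (simp add: lattice_vec_def vec_eq_iff)

lemma lattice_vec_diff: "lattice_vec (m - n) = lattice_vec m - lattice_vec n"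
  by (simp add: lattice_vec_def vec_eq_iff)

lemma lattice_point_near:
  fixes u :: "real ^ 'n"
  obtains m where "norm (u - lattice_vec m) \<le> CARD('n)"
proof -
  define m :: "int ^ 'n" where "m = (\<chi> i. \<lfloor>u $ i\<rfloor>)"
  have "norm (u - lattice_vec m) \<le> (\<Sum>i\<in>UNIV. \<bar>(u - lattice_vec m) $ i\<bar>)"
    by (rule norm_le_l1_cart)
  also have "\<dots> \<le> (\<Sum>i\<in>(UNIV :: 'n set). 1)"
    by (rule sum_mono) (simp add: m_def lattice_vec_def, linarith)
  finally show ?thesis using that by simp
qed

lemma finite_lattice_ball: "finite {n :: int ^ 'n. norm (lattice_vec n) \<le> M}"
proof (rule finite_imageD)
  have "n $ i \<in> {-\<lceil>M\<rceil>..\<lceil>M\<rceil>}" if "norm (lattice_vec n) \<le> M" for n :: "int ^ 'n" and i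
    using component_le_norm_cart[of "lattice_vec n" i] that
    by (simp add: lattice_vec_def) linarith
  then have "vec_nth ` {n :: int ^ 'n. norm (lattice_vec n) \<le> M} \<subseteq> (\<Pi>\<^sub>E i\<in>UNIV. {-\<lceil>M\<rceil>..\<lceil>M\<rceil>})"
    by (auto simp: PiE_UNIV_domain)
  then show "finite (vec_nth ` {n :: int ^ 'n. norm (lattice_vec n) \<le> M})"
    by (rule finite_subset) (simp add: finite_PiE)
  show "inj_on vec_nth {n :: int ^ 'n. norm (lattice_vec n) \<le> M}"
    by (simp add: inj_on_def vec_nth_inject)
qed

text \<open>The translation flow of \<open>V\<close> on the torus is almost periodic, so its return times to a
  neighbourhood of the origin are relatively dense. Concretely, round each \<open>v \<in> V\<close> to a lattice
  point \<open>p v\<close>. The remainders form a bounded set, which finitely many balls of radius \<open>t\<close> around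
  remainders of points \<open>w \<in> F\<close> cover; if \<open>v\<close> and \<open>w\<close> have nearby remainders, then \<open>p v - p w\<close> is a
  lattice point close to \<open>v - w \<in> V\<close>, at bounded distance from \<open>v\<close>.\<close>

lemma lattice_points_relatively_dense:
  fixes V :: "(real ^ 'n) set"
  assumes V: "subspace V" and t: "t > 0"
  obtains L where "\<And>v. v \<in> V \<Longrightarrow> \<exists>n. lattice_vec n \<in> thicken V t \<and> norm (v - lattice_vec n) \<le> L"
proof -
  define D where "D = real CARD('n)"
  have "\<exists>m. norm (v - lattice_vec m) \<le> D" for v :: "real ^ 'n"
    using lattice_point_near[of v] D_def by metis
  then obtain p :: "real ^ 'n \<Rightarrow> int ^ 'n" where p: "\<And>v. norm (v - lattice_vec (p v)) \<le> D"
    by metis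
  define f where "f v = v - lattice_vec (p v)" for v
  have "bounded (f ` V)" unfolding bounded_iff using p f_def by auto
  then have cpt: "compact (closure (f ` V))" by (simp add: compact_closure)
  have cover: "closure (f ` V) \<subseteq> (\<Union>w\<in>V. ball (f w) t)"
    using t by (auto simp: closure_approachable)
  obtain F where F: "F \<subseteq> V" "finite F" "closure (f ` V) \<subseteq> (\<Union>w\<in>F. ball (f w) t)"
    by (rule compactE_image[OF cpt open_ball cover])
  define L where "L = (\<Sum>w\<in>F. norm w) + t"
  show ?thesis
  proof (rule that)
    fix v assume v: "v \<in> V"
    then have "f v \<in> closure (f ` V)" by (intro subsetD[OF closure_subset] imageI)
    then obtain w where w: "w \<in> F" "dist (f w) (f v) < t"
      using F(3) by (meson UN_E mem_ball subsetD)
    have eq: "(v - w) - lattice_vec (p v - p w) = f v - f w"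
      by (simp add: f_def lattice_vec_diff)
    have less: "norm (f v - f w) < t" using w by (simp add: dist_norm norm_minus_commute)
    have "v - w \<in> V" using v w F V by (auto intro: subspace_diff)
    then have "lattice_vec (p v - p w) \<in> thicken V t"
      unfolding mem_thicken_subspace[OF V]
      by (rule bexI[rotated]) (use less eq in \<open>metis less_imp_le norm_minus_commute\<close>)
    moreover have "norm (v - lattice_vec (p v - p w)) \<le> L"
    proof -
      have "v - lattice_vec (p v - p w) = w + (f v - f w)" using eq by (simp add: algebra_simps)
      then have "norm (v - lattice_vec (p v - p w)) \<le> norm w + t"
        using norm_triangle_ineq[of w "f v - f w"] less by simp
      moreover have "norm w \<le> (\<Sum>w\<in>F. norm w)"
        using w F by (intro member_le_sum) auto
      ultimately show ?thesis by (simp add: L_def)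
    qed
    ultimately show "\<exists>n. lattice_vec n \<in> thicken V t \<and> norm (v - lattice_vec n) \<le> L" by blast
  qed
qed

section \<open>Orthogonal projections\<close>

lemma closest_point_orthogonal_decomp:
  fixes V :: "('a::euclidean_space) set"
  assumes V: "subspace V" and y: "y \<in> V" and z: "\<And>w. w \<in> V \<Longrightarrow> orthogonal z w"
  shows "closest_point V (y + z) = y"
proof (rule closest_point_unique[symmetric])
  show "convex V" "closed V" "y \<in> V"
    using V y by (auto simp: subspace_imp_convex closed_subspace)
  show "\<forall>w\<in>V. dist (y + z) y \<le> dist (y + z) w"
  proof
    fix w assume "w \<in> V"
    then have "orthogonal z (y - w)" using z V y by (simp add: subspace_diff)
    then have "(norm (z + (y - w)))\<^sup>2 = (norm z)\<^sup>2 + (norm (y - w))\<^sup>2"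
      by (rule norm_add_Pythagorean)
    then have "(norm z)\<^sup>2 \<le> (norm (z + (y - w)))\<^sup>2" by simp
    then have "norm z \<le> norm (z + (y - w))" by (rule power2_le_imp_le) simp
    moreover have "(y + z) - w = z + (y - w)" by simp
    ultimately show "dist (y + z) y \<le> dist (y + z) w" by (metis add_diff_cancel_left' dist_norm)
  qed
qed

text \<open>Without linearity the matrix of \<open>closest_point V\<close>, which is built from its values on the
  standard basis, would not control its values at the other points.\<close>

lemma linear_closest_point:
  fixes V :: "('a::euclidean_space) set"
  assumes V: "subspace V"
  shows "linear (closest_point V)"
proof -
  have decomp: "\<exists>y z. x = y + z \<and> y \<in> V \<and> (\<forall>w\<in>V. orthogonal z w)" for x
    using orthogonal_subspace_decomp_exists[of V x] V by (metis span_eq_iff)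
  show ?thesis
  proof (rule linearI)
    fix a b :: 'a
    obtain y z where a: "a = y + z" "y \<in> V" "\<forall>w\<in>V. orthogonal z w" using decomp by blast
    obtain y' z' where b: "b = y' + z'" "y' \<in> V" "\<forall>w\<in>V. orthogonal z' w" using decomp by blast
    have "closest_point V ((y + y') + (z + z')) = y + y'"
      using a b V
      by (intro closest_point_orthogonal_decomp) (auto simp: subspace_add orthogonal_clauses)
    then show "closest_point V (a + b) = closest_point V a + closest_point V b"
      using a b V by (simp add: closest_point_orthogonal_decomp algebra_simps)
  next
    fix r :: real and a :: 'a
    obtain y z where a: "a = y + z" "y \<in> V" "\<forall>w\<in>V. orthogonal z w" using decomp by blast
    have "closest_point V (r *\<^sub>R y + r *\<^sub>R z) = r *\<^sub>R y"
      using a V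
      by (intro closest_point_orthogonal_decomp) (auto simp: subspace_scale orthogonal_clauses)
    then show "closest_point V (r *\<^sub>R a) = r *\<^sub>R closest_point V a"
      using a V by (simp add: closest_point_orthogonal_decomp algebra_simps)
  qed
qed

text \<open>A crude bound in terms of the Euclidean norm on matrices, which is the norm that defines the
  topology of the Grassmannian.\<close>

lemma norm_matrix_vector_mult_le:
  fixes A :: "real ^ 'n ^ 'm"
  shows "norm (A *v x) \<le> CARD('m) * norm A * norm x"
proof -
  have "norm (A *v x) \<le> (\<Sum>i\<in>UNIV. \<bar>(A *v x) $ i\<bar>)" by (rule norm_le_l1_cart)
  also have "\<dots> \<le> (\<Sum>i\<in>(UNIV :: 'm set). norm A * norm x)"
  proof (rule sum_mono)
    fix i
    have "\<bar>(A *v x) $ i\<bar> \<le> norm (A $ i) * norm x"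
      by (simp add: matrix_vector_mul_component Cauchy_Schwarz_ineq2)
    also have "\<dots> \<le> norm A * norm x"
      by (intro mult_right_mono Finite_Cartesian_Product.norm_nth_le norm_ge_zero)
    finally show "\<bar>(A *v x) $ i\<bar> \<le> norm A * norm x" .
  qed
  finally show ?thesis by simp
qed

text \<open>The projection to \<open>V\<close> fixes each \<open>v \<in> V\<close>, so \<open>v\<close> is moved by the projection to \<open>W\<close> only by
  the difference of the two projections applied to \<open>v\<close>.\<close>

lemma subspace_in_cone_of_close_projections:
  fixes V W :: "(real ^ 'n) set"
  assumes V: "subspace V" and W: "subspace W" and v: "v \<in> V"
  shows "v \<in> thicken W (CARD('n) * norm (matrix (closest_point V) - matrix (closest_point W)) * norm v)"
proof -
  have "W \<noteq> {}" using W subspace_0 by blast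
  then have "closest_point W v \<in> W"
    using W by (simp add: closest_point_in_set closed_subspace)
  moreover have "v - closest_point W v =
      (matrix (closest_point V) - matrix (closest_point W)) *v v"
    using closest_point_self[OF v]
    by (simp add: matrix_vector_mult_diff_rdistrib matrix_works linear_closest_point V W)
  ultimately show ?thesis
    using norm_matrix_vector_mult_le[of "matrix (closest_point V) - matrix (closest_point W)" v]
    unfolding mem_thicken_subspace[OF W] by metis
qed

section \<open>Homoclinic points\<close>

lemma homoclinic_along_iff:
  fixes \<beta> :: "int ^ 'n \<Rightarrow> 'a \<Rightarrow> 'a::metric_space"
  shows "homoclinic_along \<beta> V y x \<longleftrightarrow>
     (\<exists>t>0. \<forall>e>0. \<exists>r. \<forall>n. lattice_vec n \<in> thicken V t \<longrightarrow> norm (lattice_vec n) \<ge> r \<longrightarrow>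
        dist (\<beta> n x) (\<beta> n y) < e)"
proof -
  have "eventually P (inf (filtercomap lattice_vec at_infinity) (principal (lattice_points F))) \<longleftrightarrow>
      (\<exists>r. \<forall>n. lattice_vec n \<in> F \<longrightarrow> norm (lattice_vec n) \<ge> r \<longrightarrow> P n)"
      (is "?L \<longleftrightarrow> ?R") for P and F :: "(real ^ 'n) set"
  proof
    show "?L \<Longrightarrow> ?R"
      unfolding eventually_inf_principal eventually_filtercomap eventually_at_infinity lattice_points_def
      by blast
    assume ?R
    then obtain r where r: "\<And>n. lattice_vec n \<in> F \<Longrightarrow> norm (lattice_vec n) \<ge> r \<Longrightarrow> P n" by blast
    show ?L
      unfolding eventually_inf_principal eventually_filtercomap eventually_at_infinity lattice_points_def
      by (rule exI[of _ "\<lambda>x. norm x \<ge> r"]) (use r in auto)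
  qed
  then show ?thesis
    by (simp add: homoclinic_along_def tendsto_iff)
qed

locale compact_Zd_action =
  fixes X :: "'a::metric_space set" and \<beta> :: "int ^ 'n \<Rightarrow> 'a \<Rightarrow> 'a"
  assumes compact_space: "compact X" and action: "Zd_action X \<beta>"
begin

lemma action_in: "x \<in> X \<Longrightarrow> \<beta> n x \<in> X"
  using action unfolding Zd_action_def homeomorphism_def by blast

lemma action_add: "x \<in> X \<Longrightarrow> \<beta> (m + n) x = \<beta> m (\<beta> n x)"
  using action unfolding Zd_action_def by blast

lemma continuous_on_action: "continuous_on X (\<beta> n)"
  using action unfolding Zd_action_def homeomorphism_def by blast

lemma action_zero:
  assumes "x \<in> X"
  shows "\<beta> 0 x = x"
proof -
  have "\<beta> 0 ` X = X" using action unfolding Zd_action_def homeomorphism_def by blast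
  then obtain z where "z \<in> X" "x = \<beta> 0 z" using assms by blast
  then show ?thesis using action_add[of z 0 0] by simp
qed

lemma equicontinuous_on_lattice_ball:
  assumes "e > 0"
  obtains d where "d > 0"
    "\<And>q x y. norm (lattice_vec q) \<le> M \<Longrightarrow> x \<in> X \<Longrightarrow> y \<in> X \<Longrightarrow> dist x y < d \<Longrightarrow> dist (\<beta> q x) (\<beta> q y) < e"
proof -
  define B where "B = insert 0 {q :: int ^ 'n. norm (lattice_vec q) \<le> M}"
  have B: "finite B" "B \<noteq> {}" by (auto simp: B_def finite_lattice_ball)
  have "\<exists>d>0. \<forall>x\<in>X. \<forall>y\<in>X. dist x y < d \<longrightarrow> dist (\<beta> q x) (\<beta> q y) < e" for q
    using compact_uniformly_continuous[OF continuous_on_action compact_space, of q] assms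
    unfolding uniformly_continuous_on_def by (metis dist_commute)
  then obtain d where d: "\<And>q. d q > 0"
    "\<And>q x y. x \<in> X \<Longrightarrow> y \<in> X \<Longrightarrow> dist x y < d q \<Longrightarrow> dist (\<beta> q x) (\<beta> q y) < e"
    by metis
  show ?thesis
  proof (rule that)
    show "Min (d ` B) > 0" using B d by simp
    fix q :: "int ^ 'n" and x y assume "norm (lattice_vec q) \<le> M" "x \<in> X" "y \<in> X" "dist x y < Min (d ` B)"
    then show "dist (\<beta> q x) (\<beta> q y) < e" using B d(2)[of x y q] by (auto simp: B_def)
  qed
qed

text \<open>A point of \<open>V\<^sup>T\<close> is within bounded distance \<open>T + L\<close> of a lattice point of the given strip \<open>V\<^sup>t\<close>,
  where the orbits are already as close as one likes; a bounded shift preserves this by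
  equicontinuity.\<close>

lemma homoclinic_along_any_width:
  assumes V: "subspace V" and x: "x \<in> X" and y: "y \<in> X"
    and hom: "homoclinic_along \<beta> V y x" and e: "e > 0"
  obtains r where "\<And>n. lattice_vec n \<in> thicken V T \<Longrightarrow> norm (lattice_vec n) \<ge> r \<Longrightarrow>
    dist (\<beta> n x) (\<beta> n y) < e"
proof -
  obtain t where t: "t > 0" and lim: "\<And>e. e > 0 \<Longrightarrow> \<exists>r. \<forall>n. lattice_vec n \<in> thicken V t \<longrightarrow>
      norm (lattice_vec n) \<ge> r \<longrightarrow> dist (\<beta> n x) (\<beta> n y) < e"
    using hom unfolding homoclinic_along_iff by blast
  obtain L where L: "\<And>v. v \<in> V \<Longrightarrow> \<exists>n. lattice_vec n \<in> thicken V t \<and> norm (v - lattice_vec n) \<le> L"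
    using lattice_points_relatively_dense[OF V t] by blast
  obtain d where d: "d > 0" "\<And>q x y. norm (lattice_vec q) \<le> T + L \<Longrightarrow> x \<in> X \<Longrightarrow> y \<in> X \<Longrightarrow>
      dist x y < d \<Longrightarrow> dist (\<beta> q x) (\<beta> q y) < e"
    using equicontinuous_on_lattice_ball[OF e] by metis
  obtain r where r: "\<And>n. lattice_vec n \<in> thicken V t \<Longrightarrow> norm (lattice_vec n) \<ge> r \<Longrightarrow>
      dist (\<beta> n x) (\<beta> n y) < d"
    using lim[OF d(1)] by blast
  show ?thesis
  proof (rule that)
    fix n assume n: "lattice_vec n \<in> thicken V T" "norm (lattice_vec n) \<ge> r + (T + L)"
    obtain v where v: "v \<in> V" "norm (lattice_vec n - v) \<le> T"
      using n V by (auto simp: mem_thicken_subspace)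
    obtain m where m: "lattice_vec m \<in> thicken V t" "norm (v - lattice_vec m) \<le> L"
      using L v by blast
    have q: "norm (lattice_vec (n - m)) \<le> T + L"
      using norm_triangle_ineq[of "lattice_vec n - v" "v - lattice_vec m"] v m
      by (simp add: lattice_vec_diff)
    have "norm (lattice_vec m) \<ge> r"
      using norm_triangle_ineq[of "lattice_vec m" "lattice_vec (n - m)"] q n
      by (simp add: lattice_vec_diff)
    then have "dist (\<beta> m x) (\<beta> m y) < d" using r m by blast
    then have "dist (\<beta> (n - m) (\<beta> m x)) (\<beta> (n - m) (\<beta> m y)) < e"
      using d q x y action_in by blast
    then show "dist (\<beta> n x) (\<beta> n y) < e"
      using action_add[of _ "n - m" m] x y by simp
  qed
qed

section \<open>Coding\<close>

text \<open>The condition \<open>rho \<beta> F x y \<le> e\<close> for \<open>e \<ge> 0\<close>, without the supremum.\<close>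

definition close_on where
  "close_on e F x y \<longleftrightarrow> (\<forall>n. lattice_vec n \<in> F \<longrightarrow> dist (\<beta> n x) (\<beta> n y) \<le> e)"

text \<open>The region \<open>V\<^sup>t \<inter> cball 0 R\<close> determines the ball of radius \<open>s\<close> at precision \<open>e\<close>. The precision is
  the same in hypothesis and conclusion, which is what allows the implication to be iterated.\<close>

definition codes where
  "codes e V t R s \<longleftrightarrow>
     (\<forall>x\<in>X. \<forall>y\<in>X. close_on e (thicken V t \<inter> cball 0 R) x y \<longrightarrow> close_on e (cball 0 s) x y)"

lemma close_on_mono: "F \<subseteq> G \<Longrightarrow> close_on e G x y \<Longrightarrow> close_on e F x y"
  by (auto simp: close_on_def)

definition expansive_with where
  "expansive_with e F \<longleftrightarrow> (\<forall>x\<in>X. \<forall>y\<in>X. close_on e F x y \<longrightarrow> x = y)"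

lemma expansive_obtain:
  assumes "expansive X \<beta> F"
  obtains e t where "e > 0" "t > 0" "expansive_with e (thicken F t)"
proof -
  obtain e t where et: "e > 0" "t > 0"
    "\<And>x y. x \<in> X \<Longrightarrow> y \<in> X \<Longrightarrow> rho \<beta> (thicken F t) x y \<le> e \<Longrightarrow> x = y"
    using assms unfolding expansive_def by blast
  have "rho \<beta> (thicken F t) x y \<le> e" if "close_on e (thicken F t) x y" for x y
    using that \<open>e > 0\<close> unfolding rho_def close_on_def lattice_points_def
    by (auto intro!: cSUP_least)
  then show ?thesis using that et unfolding expansive_with_def by blast
qed

text \<open>If no finite window sufficed, pairs of points at distance at least \<open>d\<close> that are \<open>e\<close>-close on
  larger and larger windows would accumulate at a pair that is \<open>e\<close>-close on all of \<open>F\<close> but still at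
  distance at least \<open>d\<close>.\<close>

lemma expansive_with_uniform:
  assumes exp: "expansive_with e F" and d: "d > 0"
  obtains R where "\<And>x y. x \<in> X \<Longrightarrow> y \<in> X \<Longrightarrow> close_on e (F \<inter> cball 0 R) x y \<Longrightarrow> dist x y < d"
proof (rule ccontr)
  assume "\<not> thesis"
  with that have "\<exists>x y. x \<in> X \<and> y \<in> X \<and> close_on e (F \<inter> cball 0 R) x y \<and> \<not> dist x y < d" for R
    by meson
  then have "\<exists>z. z \<in> X \<times> X \<and> close_on e (F \<inter> cball 0 (real k)) (fst z) (snd z) \<and> dist (fst z) (snd z) \<ge> d" for k
    by (metis fst_conv snd_conv mem_Times_iff not_less)
  then obtain z where z: "\<And>k. z k \<in> X \<times> X"
      "\<And>k. close_on e (F \<inter> cball 0 (real k)) (fst (z k)) (snd (z k))"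
      "\<And>k. dist (fst (z k)) (snd (z k)) \<ge> d"
    by metis
  have "seq_compact (X \<times> X)"
    by (simp add: compact_Times compact_space compact_imp_seq_compact)
  then obtain l h where l: "l \<in> X \<times> X" and h: "strict_mono (h :: nat \<Rightarrow> nat)" "(z \<circ> h) \<longlonglongrightarrow> l"
    using seq_compactE[of "X \<times> X" z] z(1) by blast
  have lim: "(\<lambda>k. fst (z (h k))) \<longlonglongrightarrow> fst l" "(\<lambda>k. snd (z (h k))) \<longlonglongrightarrow> snd l"
    using tendsto_fst[OF h(2)] tendsto_snd[OF h(2)] by (simp_all add: o_def)
  have inX: "fst l \<in> X" "snd l \<in> X" "\<And>k. fst (z k) \<in> X" "\<And>k. snd (z k) \<in> X"
    using l z(1) by (auto simp: mem_Times_iff)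
  have "close_on e F (fst l) (snd l)"
    unfolding close_on_def
  proof (intro allI impI)
    fix n assume n: "lattice_vec n \<in> F"
    have "(\<lambda>k. dist (\<beta> n (fst (z (h k)))) (\<beta> n (snd (z (h k))))) \<longlonglongrightarrow> dist (\<beta> n (fst l)) (\<beta> n (snd l))"
      by (intro tendsto_dist continuous_on_tendsto_compose[OF continuous_on_action] lim)
        (auto simp: inX)
    moreover have "\<forall>\<^sub>F k in sequentially. dist (\<beta> n (fst (z (h k)))) (\<beta> n (snd (z (h k)))) \<le> e"
    proof (rule eventually_sequentiallyI)
      fix k assume k: "nat \<lceil>norm (lattice_vec n)\<rceil> \<le> k"
      have "norm (lattice_vec n) \<le> real (h k)"
        using k seq_suble[OF h(1), of k] by linarith
      then show "dist (\<beta> n (fst (z (h k)))) (\<beta> n (snd (z (h k)))) \<le> e"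
        using z(2)[of "h k"] n by (auto simp: close_on_def)
    qed
    ultimately show "dist (\<beta> n (fst l)) (\<beta> n (snd l)) \<le> e"
      by (rule tendsto_upperbound) simp
  qed
  then have "fst l = snd l" using exp inX by (simp add: expansive_with_def)
  moreover have "d \<le> dist (fst l) (snd l)"
    by (rule tendsto_lowerbound[OF tendsto_dist[OF lim]]) (simp_all add: z(3))
  ultimately show False using d by simp
qed

lemma expansive_codes:
  assumes exp: "expansive_with e (thicken V t)" and e: "e > 0"
  obtains R where "R > 0" "codes e V t R s"
proof -
  obtain d where d: "d > 0" "\<And>q x y. norm (lattice_vec q) \<le> s \<Longrightarrow> x \<in> X \<Longrightarrow> y \<in> X \<Longrightarrow>
      dist x y < d \<Longrightarrow> dist (\<beta> q x) (\<beta> q y) < e"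
    using equicontinuous_on_lattice_ball[OF e] by metis
  obtain R where R: "\<And>x y. x \<in> X \<Longrightarrow> y \<in> X \<Longrightarrow> close_on e (thicken V t \<inter> cball 0 R) x y \<Longrightarrow> dist x y < d"
    using expansive_with_uniform[OF exp d(1)] by blast
  have "codes e V t (max R 1) s"
    unfolding codes_def
  proof (intro ballI impI)
    fix x y assume xy: "x \<in> X" "y \<in> X" "close_on e (thicken V t \<inter> cball 0 (max R 1)) x y"
    then have "close_on e (thicken V t \<inter> cball 0 R) x y" by (auto simp: close_on_def)
    then show "close_on e (cball 0 s) x y"
      using d R xy by (force simp: close_on_def less_imp_le)
  qed
  then show ?thesis using that[of "max R 1"] by simp
qed

text \<open>A coding only refers to a bounded part of \<open>V\<^sup>t\<close>, and this part lies in \<open>W\<^bsup>t+1\<^esup>\<close> when \<open>W\<close> is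
  close to \<open>V\<close>. The radii \<open>R\<close> and \<open>s\<close> do not change, which gives uniformity in \<open>W\<close>.\<close>

lemma codes_transfer:
  assumes V: "subspace V" and W: "subspace W" and codes: "codes e V t R s"
    and cone: "\<And>v. v \<in> V \<Longrightarrow> v \<in> thicken W (c * norm v)"
    and c: "c \<ge> 0" "c * (R + t) \<le> 1"
  shows "codes e W (t + 1) R s"
proof -
  have "thicken V t \<inter> cball 0 R \<subseteq> thicken W (t + 1) \<inter> cball 0 R"
  proof
    fix q assume q: "q \<in> thicken V t \<inter> cball 0 R"
    then obtain v where v: "v \<in> V" "norm (q - v) \<le> t" using V by (auto simp: mem_thicken_subspace)
    have "norm v \<le> R + t" using norm_triangle_ineq[of q "v - q"] q v by (simp add: norm_minus_commute)
    then have "c * norm v \<le> 1" using c mult_left_mono[of "norm v" "R + t" c] by linarith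
    then show "q \<in> thicken W (t + 1) \<inter> cball 0 R"
      using thicken_perturb[OF W cone[OF v(1)] v(2)] q by simp
  qed
  then show ?thesis using codes close_on_mono unfolding codes_def by blast
qed

lemma codes_translate:
  assumes codes: "codes e V t R s" and x: "x \<in> X" and y: "y \<in> X"
    and close: "\<And>q. lattice_vec q \<in> thicken V t \<Longrightarrow> norm (lattice_vec q) \<le> R \<Longrightarrow>
      dist (\<beta> (m + q) x) (\<beta> (m + q) y) \<le> e"
    and n: "norm (lattice_vec n - lattice_vec m) \<le> s"
  shows "dist (\<beta> n x) (\<beta> n y) \<le> e"
proof -
  have "close_on e (thicken V t \<inter> cball 0 R) (\<beta> m x) (\<beta> m y)"
    using close x y by (auto simp: close_on_def action_add[symmetric] add.commute)
  then have "close_on e (cball 0 s) (\<beta> m x) (\<beta> m y)"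
    using codes x y action_in unfolding codes_def by blast
  then have "dist (\<beta> (n - m) (\<beta> m x)) (\<beta> (n - m) (\<beta> m y)) \<le> e"
    using n by (simp add: close_on_def lattice_vec_diff)
  then show ?thesis using action_add[of _ "n - m" m] x y by simp
qed

text \<open>A lattice point \<open>n\<close> at height at most \<open>t + D + (j + 1)\<close> over \<open>V\<close> is reached from a lattice point
  \<open>m\<close> at height at most \<open>D + j\<close>: move \<open>n\<close> straight towards \<open>V\<close> by at most \<open>t + D + 1\<close> and round. The
  window \<open>m + (V\<^sup>t \<inter> cball 0 R)\<close> then has height at most \<open>t + D + j\<close>, and \<open>n\<close> is within
  \<open>t + 2 * D + 1\<close> of \<open>m\<close>. This is where the radius in the coding comes from.\<close>

lemma coding_spreads_to_cone:
  fixes V :: "(real ^ 'n) set" and j :: nat and D :: real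
  defines "D \<equiv> real CARD('n)"
  assumes V: "subspace V" and t: "t > 0" and codes: "codes e V t R (t + 2 * D + 1)"
    and x: "x \<in> X" and y: "y \<in> X"
    and close: "\<And>n. lattice_vec n \<in> thicken V (t + D) \<Longrightarrow> norm (lattice_vec n) \<ge> r \<Longrightarrow>
      dist (\<beta> n x) (\<beta> n y) \<le> e"
  shows "lattice_vec n \<in> thicken V (t + D + j) \<Longrightarrow>
    norm (lattice_vec n) \<ge> r + j * (R + (t + 2 * D + 1)) \<Longrightarrow> dist (\<beta> n x) (\<beta> n y) \<le> e"
proof (induction j arbitrary: n)
  case 0
  then show ?case using close by simp
next
  case (Suc j)
  obtain v where v: "v \<in> V" "norm (lattice_vec n - v) \<le> t + D + (j + 1)"
    using Suc.prems V by (auto simp: mem_thicken_subspace add_ac)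
  have pos: "t + D + (j + 1) > 0" using t by (simp add: D_def)
  \<comment> \<open>The contraction factor that takes height \<open>t + D + (j + 1)\<close> to height \<open>j\<close>.\<close>
  define a where "a = j / (t + D + (j + 1))"
  have a: "0 \<le> a" "a \<le> 1" using t by (auto simp: a_def D_def divide_simps)
  define u where "u = v + a *\<^sub>R (lattice_vec n - v)"
  have uv: "norm (u - v) \<le> j"
    using mult_left_mono[OF v(2) a(1)] a pos by (simp add: u_def a_def)
  have "norm (lattice_vec n - u) = (1 - a) * norm (lattice_vec n - v)"
  proof -
    have "lattice_vec n - u = (1 - a) *\<^sub>R (lattice_vec n - v)" by (simp add: u_def algebra_simps)
    then show ?thesis using a by simp
  qed
  also have "\<dots> \<le> (1 - a) * (t + D + (j + 1))" using v a by (intro mult_left_mono) auto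
  also have "\<dots> = t + D + 1"
  proof -
    have "a * (t + D + (j + 1)) = j" using pos by (simp add: a_def)
    then show ?thesis by (simp add: algebra_simps)
  qed
  finally have nu: "norm (lattice_vec n - u) \<le> t + D + 1" .
  obtain m where m: "norm (u - lattice_vec m) \<le> D"
    using lattice_point_near D_def by metis
  have nm: "norm (lattice_vec n - lattice_vec m) \<le> t + 2 * D + 1"
    using norm_triangle_ineq[of "lattice_vec n - u" "u - lattice_vec m"] nu m by simp
  have mV: "lattice_vec m \<in> thicken V (D + j)"
  proof -
    have "u \<in> thicken V j" using uv v V by (auto simp: mem_thicken_subspace)
    then show ?thesis
      by (rule thicken_perturb[OF V]) (use m in \<open>simp_all add: norm_minus_commute\<close>)
  qed
  show ?case
  proof (rule codes_translate[OF codes x y _ nm])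
    fix q assume q: "lattice_vec q \<in> thicken V t" "norm (lattice_vec q) \<le> R"
    show "dist (\<beta> (m + q) x) (\<beta> (m + q) y) \<le> e"
    proof (rule Suc.IH)
      show "lattice_vec (m + q) \<in> thicken V (t + D + j)"
        using thicken_add[OF V mV q(1)] by (simp add: lattice_vec_add add_ac)
      have "norm (lattice_vec n) \<le> norm (lattice_vec (m + q)) + norm (lattice_vec n - lattice_vec m) + norm (lattice_vec q)"
        using norm_triangle_ineq[of "lattice_vec (m + q)" "(lattice_vec n - lattice_vec m) - lattice_vec q"]
          norm_triangle_ineq4[of "lattice_vec n - lattice_vec m" "lattice_vec q"]
        by (simp add: lattice_vec_add algebra_simps)
      then show "r + j * (R + (t + 2 * D + 1)) \<le> norm (lattice_vec (m + q))"
        using nm q Suc.prems(2) by (simp add: algebra_simps)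
    qed
  qed
qed

text \<open>The cone on which the orbits are \<open>e\<close>-close has slope \<open>1 / (R + s)\<close> with \<open>s = t + 2 * D + 1\<close>,
  and \<open>W\<close> has at most half that slope. Hence for each fixed \<open>M\<close> the ball of radius \<open>M\<close> around a point
  of \<open>W\<^sup>1\<close> lies in the cone once the point is far enough from the origin, and expansiveness turns
  \<open>e\<close>-closeness on such balls into arbitrary closeness at the centre. The set \<open>F\<close> for this last step can be any set
  for which \<open>e\<close> is an expansive constant, so \<open>W\<close> and \<open>V\<close> may share one.\<close>

lemma homoclinic_along_transfer:
  fixes V W :: "(real ^ 'n) set" and D :: real
  defines "D \<equiv> real CARD('n)"
  assumes V: "subspace V" and W: "subspace W" and t: "t > 0" and R: "R > 0"
    and codes: "codes e V t R (t + 2 * D + 1)" and e: "e > 0" and exp: "expansive_with e F"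
    and cone: "\<And>w. w \<in> W \<Longrightarrow> w \<in> thicken V (c * norm w)"
    and c: "c \<ge> 0" "2 * c * (R + (t + 2 * D + 1)) \<le> 1"
    and x: "x \<in> X" and y: "y \<in> X" and hom: "homoclinic_along \<beta> V y x"
  shows "homoclinic_along \<beta> W y x"
proof -
  define K where "K = R + (t + 2 * D + 1)"
  have K: "K > 0" "c * K \<le> 1 / 2" using R t c by (auto simp: K_def D_def)
  obtain r where r: "\<And>n. lattice_vec n \<in> thicken V (t + D) \<Longrightarrow> norm (lattice_vec n) \<ge> r \<Longrightarrow>
      dist (\<beta> n x) (\<beta> n y) < e"
    using homoclinic_along_any_width[OF V x y hom e] by blast
  have spread: "dist (\<beta> n x) (\<beta> n y) \<le> e"
    if "lattice_vec n \<in> thicken V (t + D + j)" "norm (lattice_vec n) \<ge> r + j * K" for n and j :: nat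
    using coding_spreads_to_cone[OF V t, of e R x y r n j] codes x y r that
    unfolding D_def K_def by (simp add: less_imp_le)
  have "\<exists>N. \<forall>n. lattice_vec n \<in> thicken W 1 \<longrightarrow> norm (lattice_vec n) \<ge> N \<longrightarrow>
      dist (\<beta> n x) (\<beta> n y) < d" if d: "d > 0" for d
  proof -
    obtain M' where M': "\<And>x y. x \<in> X \<Longrightarrow> y \<in> X \<Longrightarrow> close_on e (F \<inter> cball 0 M') x y \<Longrightarrow> dist x y < d"
      using expansive_with_uniform[OF exp d] by blast
    define M where "M = max M' 0"
    define N where "N = 2 * (M + r + K * (M + 2 + c))"
    have "dist (\<beta> n x) (\<beta> n y) < d"
      if n: "lattice_vec n \<in> thicken W 1" "norm (lattice_vec n) \<ge> N" for n
    proof -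
      obtain w where w: "w \<in> W" "norm (lattice_vec n - w) \<le> 1"
        using n W by (auto simp: mem_thicken_subspace)
      have "norm w \<le> norm (lattice_vec n) + 1"
        using norm_triangle_ineq[of "lattice_vec n" "w - lattice_vec n"] w
        by (simp add: norm_minus_commute)
      then have cw: "c * norm w \<le> c * (norm (lattice_vec n) + 1)" using c by (intro mult_left_mono)
      \<comment> \<open>The number of spreading steps that lift the strip above the ball of radius \<open>M\<close> around \<open>n\<close>.\<close>
      define j where "j = nat \<lceil>M + 1 + c * (norm (lattice_vec n) + 1)\<rceil>"
      have h0: "0 \<le> M + 1 + c * (norm (lattice_vec n) + 1)" using c by (simp add: M_def)
      then have j: "M + 1 + c * (norm (lattice_vec n) + 1) \<le> j"
        "j \<le> M + 2 + c * (norm (lattice_vec n) + 1)"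
        unfolding j_def by linarith+
      have "j * K \<le> (M + 2 + c * (norm (lattice_vec n) + 1)) * K"
        using j K by (intro mult_right_mono) auto
      also have "\<dots> = K * (M + 2 + c) + (c * K) * norm (lattice_vec n)" by (simp add: algebra_simps)
      also have "\<dots> \<le> K * (M + 2 + c) + 1 / 2 * norm (lattice_vec n)"
        using K by (intro add_left_mono mult_right_mono) auto
      finally have jK: "r + j * K \<le> norm (lattice_vec n) - M" using n(2) unfolding N_def by argo
      have "close_on e (F \<inter> cball 0 M') (\<beta> n x) (\<beta> n y)"
        unfolding close_on_def
      proof (intro allI impI)
        fix q assume "lattice_vec q \<in> F \<inter> cball 0 M'"
        then have q: "norm (lattice_vec q) \<le> M" by (auto simp: M_def)
        have "norm (lattice_vec (q + n) - w) \<le> M + 1"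
          using norm_triangle_ineq[of "lattice_vec q" "lattice_vec n - w"] q w
          by (simp add: lattice_vec_add algebra_simps)
        then have "lattice_vec (q + n) \<in> thicken V (t + D + j)"
          by (rule thicken_perturb[OF V cone[OF w(1)]]) (use cw j t D_def in simp)
        moreover have "norm (lattice_vec n) - M \<le> norm (lattice_vec (q + n))"
          using norm_triangle_ineq4[of "lattice_vec (q + n)" "lattice_vec q"] q
          by (simp add: lattice_vec_add)
        ultimately have "dist (\<beta> (q + n) x) (\<beta> (q + n) y) \<le> e" using spread jK by force
        then show "dist (\<beta> q (\<beta> n x)) (\<beta> q (\<beta> n y)) \<le> e" using x y by (simp add: action_add)
      qed
      then show ?thesis using M' action_in x y by blast
    qed
    then show ?thesis by blast
  qed
  then show ?thesis unfolding homoclinic_along_iff by (intro exI[of _ 1]) simp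
qed

text \<open>To treat \<open>V\<close> and \<open>W\<close> alike, both are given the coding of width \<open>t + 1\<close> that \<open>W\<close> inherits
  from \<open>V\<close>; so the radius of the coding is chosen for this width from the start.\<close>

lemma homoclinic_set_locally_constant:
  fixes V :: "(real ^ 'n) set"
  assumes V: "subspace V" and exp: "expansive X \<beta> V" and y: "y \<in> X"
  obtains d where "d > 0"
    "\<And>W. subspace W \<Longrightarrow> dist (matrix (closest_point W)) (matrix (closest_point V)) < d \<Longrightarrow>
      homoclinic_set X \<beta> y W = homoclinic_set X \<beta> y V"
proof -
  define D where "D = real CARD('n)"
  have D: "D > 0" by (simp add: D_def)
  obtain e t where et: "e > 0" "t > 0" and ew: "expansive_with e (thicken V t)"
    using expansive_obtain[OF exp] by blast
  obtain R where R: "R > 0" "codes e V t R ((t + 1) + 2 * D + 1)"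
    using expansive_codes[OF ew et(1)] by blast
  define c where "c = 1 / (2 * (R + ((t + 1) + 2 * D + 1)))"
  have c: "c > 0" "2 * c * (R + ((t + 1) + 2 * D + 1)) \<le> 1" "c * (R + t) \<le> 1"
    using R et D by (auto simp: c_def divide_simps)
  show ?thesis
  proof (rule that)
    show "c / D > 0" using c D by simp
    fix W :: "(real ^ 'n) set"
    assume W: "subspace W"
      and dist: "dist (matrix (closest_point W)) (matrix (closest_point V)) < c / D"
    then have "D * norm (matrix (closest_point W) - matrix (closest_point V)) \<le> c"
      using D by (simp add: dist_norm pos_less_divide_eq mult.commute less_imp_le)
    then have le: "D * norm (matrix (closest_point W) - matrix (closest_point V)) * norm v \<le> c * norm v"
      "D * norm (matrix (closest_point V) - matrix (closest_point W)) * norm v \<le> c * norm v"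
      for v :: "real ^ 'n"
      by (simp_all add: mult_right_mono norm_minus_commute)
    have cone_W: "w \<in> thicken V (c * norm w)" if "w \<in> W" for w
      using subspace_in_cone_of_close_projections[OF W V that] le(1)[of w]
      by (auto intro: thicken_perturb[OF V, where r = 0] simp: D_def)
    have cone_V: "v \<in> thicken W (c * norm v)" if "v \<in> V" for v
      using subspace_in_cone_of_close_projections[OF V W that] le(2)[of v]
      by (auto intro: thicken_perturb[OF W, where r = 0] simp: D_def)
    have codes_V: "codes e V (t + 1) R ((t + 1) + 2 * D + 1)"
      using codes_transfer[OF V V R(2), of 0]
      by (force simp: mem_thicken_subspace V)
    have codes_W: "codes e W (t + 1) R ((t + 1) + 2 * D + 1)"
      using codes_transfer[OF V W R(2) cone_V] c by simp
    have "homoclinic_along \<beta> V y x \<longleftrightarrow> homoclinic_along \<beta> W y x" if x: "x \<in> X" for x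
      using homoclinic_along_transfer[OF V W, of "t + 1" R e, OF _ R(1) _ et(1) ew, of c x y]
        homoclinic_along_transfer[OF W V, of "t + 1" R e, OF _ R(1) _ et(1) ew, of c x y]
        cone_V cone_W codes_V codes_W c et x y
      unfolding D_def by (meson add_pos_pos less_imp_le zero_less_one)
    then show "homoclinic_set X \<beta> y W = homoclinic_set X \<beta> y V"
      by (auto simp: homoclinic_set_def)
  qed
qed

end

section \<open>Connectedness\<close>

lemma locally_constant_on_connectedin:
  assumes conn: "connectedin T C"
    and loc: "\<And>a. a \<in> C \<Longrightarrow> \<exists>U. openin T U \<and> a \<in> U \<and> (\<forall>b\<in>U. f b = f a)"
    and "a \<in> C" "b \<in> C"
  shows "f a = f b"
proof (rule ccontr)
  assume neq: "f a \<noteq> f b"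
  define P where "P = \<Union>{U. openin T U \<and> (\<forall>z\<in>U. f z = f a)}"
  define Q where "Q = \<Union>{U. openin T U \<and> (\<forall>z\<in>U. f z \<noteq> f a)}"
  have "openin T P" "openin T Q" by (auto simp: P_def Q_def)
  moreover have cover: "(f z = f a \<longrightarrow> z \<in> P) \<and> (f z \<noteq> f a \<longrightarrow> z \<in> Q)" if "z \<in> C" for z
  proof -
    obtain U where U: "openin T U" "z \<in> U" "\<forall>b\<in>U. f b = f z" using loc[OF \<open>z \<in> C\<close>] by blast
    show ?thesis
    proof (cases "f z = f a")
      case True
      then have "\<forall>b\<in>U. f b = f a" using U(3) by metis
      then show ?thesis using True U(1,2) unfolding P_def by blast
    next
      case False
      then have "\<forall>b\<in>U. f b \<noteq> f a" using U(3) by metis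
      then show ?thesis using False U(1,2) unfolding Q_def by blast
    qed
  qed
  then have "C \<subseteq> P \<union> Q" by blast
  moreover have "P \<inter> Q \<inter> C = {}" unfolding P_def Q_def by blast
  moreover have "P \<inter> C \<noteq> {}" "Q \<inter> C \<noteq> {}"
    using cover[OF assms(3)] cover[OF assms(4)] assms(3,4) neq by auto
  ultimately show False using conn unfolding connectedin by meson
qed

theorem theorem9p6:
  fixes X :: "'a::metric_space set"
    and \<beta> :: "int ^ 'n \<Rightarrow> 'a \<Rightarrow> 'a"
    and k :: nat
    and \<C> :: "(real ^ 'n) set set"
    and y\<^sub>0 :: 'a
  assumes "compact X" and "infinite X"
    and "Zd_action X \<beta>"
    and "\<C> \<in> connected_components_of
               (subtopology (grassmannian k) (expansive_subspaces X \<beta> k))"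
    and "y\<^sub>0 \<in> X"
  shows "\<forall>V\<in>\<C>. \<forall>W\<in>\<C>. homoclinic_set X \<beta> y\<^sub>0 V = homoclinic_set X \<beta> y\<^sub>0 W"
proof -
  interpret compact_Zd_action X \<beta> using assms by unfold_locales
  let ?T = "subtopology (grassmannian k) (expansive_subspaces X \<beta> k)"
  let ?m = "\<lambda>V :: (real ^ 'n) set. matrix (closest_point V)"
  have conn: "connectedin ?T \<C>" using assms(4) by (rule connectedin_connected_components_of)
  have "\<exists>U. openin ?T U \<and> V \<in> U \<and> (\<forall>W\<in>U. homoclinic_set X \<beta> y\<^sub>0 W = homoclinic_set X \<beta> y\<^sub>0 V)"
    if "V \<in> \<C>" for V
  proof -
    have VE: "V \<in> expansive_subspaces X \<beta> k"
      using connectedin_subset_topspace[OF conn] that by auto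
    then have V: "subspace V" "dim V = k" "expansive X \<beta> V"
      by (auto simp: expansive_subspaces_def topspace_grassmannian)
    obtain d where d: "d > 0" "\<And>W. subspace W \<Longrightarrow> dist (?m W) (?m V) < d \<Longrightarrow>
        homoclinic_set X \<beta> y\<^sub>0 W = homoclinic_set X \<beta> y\<^sub>0 V"
      using homoclinic_set_locally_constant[OF V(1,3) assms(5)] by blast
    define U where "U = ?m -` ball (?m V) d \<inter> {W. subspace W \<and> dim W = k}"
    have "openin (grassmannian k) U"
      unfolding grassmannian_def openin_pullback_topology U_def
      by (auto intro: exI[of _ "ball (?m V) d"])
    then have "openin ?T (U \<inter> expansive_subspaces X \<beta> k)"
      by (auto simp: openin_subtopology)
    moreover have "V \<in> U" using V d by (simp add: U_def)
    moreover have "homoclinic_set X \<beta> y\<^sub>0 W = homoclinic_set X \<beta> y\<^sub>0 V" if "W \<in> U" for W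
      using that d(2) by (simp add: U_def dist_commute)
    ultimately show ?thesis using VE by blast
  qed
  then show ?thesis
    by (intro ballI locally_constant_on_connectedin[OF conn, where f = "homoclinic_set X \<beta> y\<^sub>0"])
qed

end
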